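(* Let $H$ be a graph and let $k$ be its degeneracy. Then $$AR(H) \leq k\, e(H) - k + v(H).$$
   Context: All graphs are finite and simple; $v(H)$ and $e(H)$ denote the numbers of vertices and edges of $H$. A proper edge colouring assigns colours to edges so that edges sharing a vertex receive distinct colours. A copy of $H$ in an edge-coloured graph is rainbow if all its edges have distinct colours. The local anti-Ramsey number $AR(H)$ is the smallest integer $n$ such that every proper edge colouring of the complete graph $K_n$ contains a rainbow copy of $H$. The degeneracy of a graph $H$ is the smallest integer $d$ for which there is an ordering $v_1,\dots,v_n$ of $V(H)$ such that $|\{1 \le j < i : v_jv_i \in E(H)\}| \le d$ for every $1 \le i \le n$. *)

theory Defs
  imports "HOL-Library.Ramsey" "HOL-Library.Extended_Nat"
begin

text \<open>
  A graph is a pair of a vertex set \<open>V\<close> and a set \<open>E\<close> of two-element subsets of \<open>V\<close>.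
  The complete graph \<open>K\<^sub>n\<close> has vertex set \<open>{..<n}\<close> and edge set \<open>[{..<n}]\<^bsup>2\<^esup>\<close>, written
  \<open>nsets {..<n} 2\<close>.
\<close>

definition simple_graph :: "'a set \<Rightarrow> 'a set set \<Rightarrow> bool" where
  "simple_graph V E \<longleftrightarrow> E \<subseteq> nsets V 2"

definition finite_simple_graph :: "'a set \<Rightarrow> 'a set set \<Rightarrow> bool" where
  "finite_simple_graph V E \<longleftrightarrow> finite V \<and> simple_graph V E"

definition subgraph :: "'a set \<Rightarrow> 'a set set \<Rightarrow> 'a set \<Rightarrow> 'a set set \<Rightarrow> bool" where
  "subgraph V' E' V E \<longleftrightarrow> V' \<subseteq> V \<and> E' \<subseteq> E \<and> simple_graph V' E'"

definition isomorphic :: "'a set \<Rightarrow> 'a set set \<Rightarrow> 'b set \<Rightarrow> 'b set set \<Rightarrow> bool" where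
  "isomorphic V E V' E' \<longleftrightarrow>
     (\<exists>f. bij_betw f V V' \<and> (\<forall>u\<in>V. \<forall>v\<in>V. {u, v} \<in> E \<longleftrightarrow> {f u, f v} \<in> E'))"

definition proper_edge_colouring :: "'a set set \<Rightarrow> ('a set \<Rightarrow> 'c) \<Rightarrow> bool" where
  "proper_edge_colouring E c \<longleftrightarrow>
     (\<forall>e\<in>E. \<forall>f\<in>E. e \<noteq> f \<and> e \<inter> f \<noteq> {} \<longrightarrow> c e \<noteq> c f)"

definition has_rainbow_copy ::
  "'a set \<Rightarrow> 'a set set \<Rightarrow> 'b set \<Rightarrow> 'b set set \<Rightarrow> ('b set \<Rightarrow> 'c) \<Rightarrow> bool" where
  "has_rainbow_copy V E W F c \<longleftrightarrow>
     (\<exists>V' E'. subgraph V' E' W F \<and> isomorphic V E V' E' \<and> inj_on c E')"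

text \<open>
  Natural numbers suffice as colours, since \<open>K\<^sub>n\<close> has finitely many edges.
  The value is \<open>\<infinity>\<close> if there is no suitable \<open>n\<close>, so that a finite upper bound on it
  entails that the minimum exists.
\<close>

definition AR :: "'a set \<Rightarrow> 'a set set \<Rightarrow> enat" where
  "AR V E = Inf {enat n | n. \<forall>c :: nat set \<Rightarrow> nat.
     proper_edge_colouring (nsets {..<n} 2) c \<longrightarrow>
     has_rainbow_copy V E {..<n} (nsets {..<n} 2) c}"

definition degeneracy :: "'a set \<Rightarrow> 'a set set \<Rightarrow> nat" where
  "degeneracy V E = (LEAST d. \<exists>vs. distinct vs \<and> set vs = V \<and>
     (\<forall>i < length vs. card {j. j < i \<and> {vs ! j, vs ! i} \<in> E} \<le> d))"

lemma degeneracy_attained: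
  assumes "finite V"
  shows "\<exists>vs. distinct vs \<and> set vs = V \<and>
     (\<forall>i < length vs. card {j. j < i \<and> {vs ! j, vs ! i} \<in> E} \<le> degeneracy V E)"
  unfolding degeneracy_def
proof (rule LeastI_ex)
  obtain vs where vs: "distinct vs" "set vs = V"
    using finite_distinct_list[OF assms] by blast
  have "card {j. j < i \<and> {vs ! j, vs ! i} \<in> E} \<le> length vs" if "i < length vs" for i
  proof -
    have "card {j. j < i \<and> {vs ! j, vs ! i} \<in> E} \<le> card {..<i}"
      by (rule card_mono) auto
    with that show ?thesis by simp
  qed
  with vs show "\<exists>d vs. distinct vs \<and> set vs = V \<and>
     (\<forall>i < length vs. card {j. j < i \<and> {vs ! j, vs ! i} \<in> E} \<le> d)"
    by blast
qed

text \<open>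
  By the next lemma, the subtraction in \<open>k * card E - k + card V\<close> with \<open>k = degeneracy V E\<close> is
  never truncated on natural numbers.
\<close>

lemma degeneracy_le_mult_card_edges:
  assumes "finite_simple_graph V E"
  shows "degeneracy V E \<le> degeneracy V E * card E"
proof (cases "E = {}")
  case True
  obtain vs where "distinct vs" "set vs = V"
    using finite_distinct_list assms unfolding finite_simple_graph_def by blast
  then have "degeneracy V E \<le> 0"
    unfolding degeneracy_def using True by (intro Least_le) auto
  then show ?thesis by simp
next
  case False
  have "finite E"
    using assms finite_subset finite_imp_finite_nsets
    unfolding finite_simple_graph_def simple_graph_def by blast
  with False have "card E \<ge> 1"
    by (simp add: Suc_le_eq card_gt_0_iff)
  then show ?thesis by simp
qed

end

theory Submission
  imports Defs
begin

text \<open>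
  Embed \<open>H\<close> greedily along a degenerate ordering. If the next vertex \<open>v\<close> has \<open>d \<le> k\<close> earlier
  neighbours, its image must avoid the at most \<open>v(H) - 1\<close> images already used and, for each
  earlier neighbour \<open>u\<close> and each colour already used, the at most one vertex joined to the image of
  \<open>u\<close> in that colour. At most \<open>e(H) - d\<close> colours have been used, so this excludes at most
  \<open>v(H) - 1 + d (e(H) - d) \<le> v(H) - 1 + k (e(H) - 1)\<close> vertices. The \<open>d\<close> new edges share a vertex,
  so they automatically receive distinct colours.
\<close>

text \<open>Two edges meeting in \<open>w\<close> cannot share a colour. This serves twice: it
  bounds the vertices that a given neighbour and colour exclude, and it separates the colours of the
  edges added in one step.\<close>

lemma proper_edge_colouring_inj_at:
  assumes "proper_edge_colouring (nsets W 2) c"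
    and "w \<in> W" "x \<in> W" "y \<in> W" "x \<noteq> w" "y \<noteq> w" "c {x, w} = c {y, w}"
  shows "x = y"
proof (rule ccontr)
  assume "x \<noteq> y"
  then have "{x, w} \<noteq> {y, w}" using assms by (auto simp: doubleton_eq_iff)
  moreover have "{x, w} \<in> nsets W 2" "{y, w} \<in> nsets W 2"
    using assms by (auto simp: nsets_def)
  ultimately have "c {x, w} \<noteq> c {y, w}"
    using assms(1) unfolding proper_edge_colouring_def by (metis IntI empty_iff insertCI)
  with assms(7) show False by contradiction
qed

lemma exists_vertex_avoiding_colours:
  assumes "finite W" and proper: "proper_edge_colouring (nsets W 2) c"
    and "finite S" "S \<subseteq> W" "T \<subseteq> S" "finite C"
    and less: "card S + card T * card C < card W"
  shows "\<exists>x \<in> W - S. \<forall>w \<in> T. c {x, w} \<notin> C"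
proof -
  \<comment> \<open>\<open>B (w, q)\<close> collects the vertices ruled out by the pair
    \<open>(w, q)\<close>. The vertex \<open>w\<close> is left out because \<open>{w, w}\<close> is
    not an edge, so properness does not constrain its colour; the \<open>x\<close> chosen below
    differs from \<open>w\<close> anyway, as \<open>T \<subseteq> S\<close>.\<close>
  define B where "B = (\<lambda>(w, q). {x \<in> W - {w}. c {x, w} = q})"
  have finT: "finite T" using \<open>T \<subseteq> S\<close> \<open>finite S\<close> by (rule finite_subset)
  have B: "finite (B p) \<and> card (B p) \<le> 1" if mem: "p \<in> T \<times> C" for p
  proof -
    obtain w q where p: "p = (w, q)" "w \<in> T" using mem by auto
    have fin: "finite (B p)" using \<open>finite W\<close> by (auto simp: B_def p)
    moreover have "x = y" if "x \<in> B p" "y \<in> B p" for x y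
    proof (rule proper_edge_colouring_inj_at[OF proper])
      show "w \<in> W" using p(2) \<open>T \<subseteq> S\<close> \<open>S \<subseteq> W\<close> by blast
    qed (use that in \<open>auto simp: B_def p(1)\<close>)
    ultimately show ?thesis by (simp add: card_le_Suc0_iff_eq)
  qed
  have "card (\<Union>p \<in> T \<times> C. B p) \<le> (\<Sum>p \<in> T \<times> C. card (B p))"
    using finT \<open>finite C\<close> by (intro card_UN_le) auto
  also have "\<dots> \<le> (\<Sum>p \<in> T \<times> C. 1)" using B by (intro sum_mono) auto
  also have "\<dots> = card T * card C" by (simp add: card_cartesian_product)
  finally have "card (S \<union> (\<Union>p \<in> T \<times> C. B p)) < card W"
    using less card_Un_le[of S "\<Union>p \<in> T \<times> C. B p"] by linarith
  moreover have "finite (S \<union> (\<Union>p \<in> T \<times> C. B p))"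
    using \<open>finite S\<close> finT \<open>finite C\<close> B by auto
  ultimately obtain x where "x \<in> W" "x \<notin> S \<union> (\<Union>p \<in> T \<times> C. B p)"
    by (meson card_mono not_le subsetI)
  moreover from this have "c {x, w} \<notin> C" if "w \<in> T" for w
    using that \<open>T \<subseteq> S\<close> by (auto simp: B_def)
  ultimately show ?thesis by blast
qed

text \<open>One greedy step: \<open>S\<close> is the part already embedded, \<open>E\<close> its
  edges, and \<open>N\<close> the earlier neighbours of the new vertex \<open>v\<close>. Being
  rainbow is phrased as injectivity of the colouring pulled back along \<open>f\<close>.\<close>

lemma extend_rainbow_embedding:
  assumes "finite W" and proper: "proper_edge_colouring (nsets W 2) c"
    and "finite S" "finite E" "E \<subseteq> nsets S 2" "v \<notin> S" "N \<subseteq> S"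
    and f: "inj_on f S" "f ` S \<subseteq> W" "inj_on (\<lambda>e. c (f ` e)) E"
    and less: "card S + card N * card E < card W"
  shows "\<exists>g. inj_on g (insert v S) \<and> g ` insert v S \<subseteq> W \<and>
    inj_on (\<lambda>e. c (g ` e)) (E \<union> (\<lambda>u. {v, u}) ` N)"
proof -
  have "card (f ` N) = card N" "card (f ` S) = card S"
    using f(1) \<open>N \<subseteq> S\<close> card_image inj_on_subset by blast+
  moreover have "card ((\<lambda>e. c (f ` e)) ` E) = card E"
    using f(3) card_image by blast
  \<comment> \<open>The counting is applied to the images of \<open>S\<close> and \<open>N\<close>
    and to the colours in use; injectivity of \<open>f\<close> and of the pulled-back colouring
    keeps the cardinalities.\<close>
  ultimately have "\<exists>x \<in> W - f ` S. \<forall>w \<in> f ` N. c {x, w} \<notin> (\<lambda>e. c (f ` e)) ` E"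
    using assms by (intro exists_vertex_avoiding_colours) auto
  then obtain x where x: "x \<in> W" "x \<notin> f ` S"
    and new: "\<And>u e. u \<in> N \<Longrightarrow> e \<in> E \<Longrightarrow> c {x, f u} \<noteq> c (f ` e)"
    by blast
  define g where "g = f(v := x)"
  have gf: "g u = f u" if "u \<in> S" for u using that \<open>v \<notin> S\<close> by (auto simp: g_def)
  have gv: "g v = x" by (simp add: g_def)
  have gE: "g ` e = f ` e" if "e \<in> E" for e
    using that \<open>E \<subseteq> nsets S 2\<close> gf by (intro image_cong) (auto simp: nsets_def)
  have gN: "g ` {v, u} = {x, f u}" if "u \<in> N" for u
    using that \<open>N \<subseteq> S\<close> gf gv by auto
  have "inj_on g (insert v S)"
    using f(1) x gf gv \<open>v \<notin> S\<close> by (auto simp: inj_on_def image_iff)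
  moreover have "g ` insert v S \<subseteq> W" using f(2) x gf gv by auto
  moreover have "inj_on (\<lambda>e. c (g ` e)) (E \<union> (\<lambda>u. {v, u}) ` N)"
  proof -
    have "inj_on (\<lambda>e. c (g ` e)) E"
      using f(3) gE by (simp add: inj_on_def)
    \<comment> \<open>The images of the new edges all meet in \<open>x\<close>, so properness alone
      separates their colours.\<close>
    moreover have "inj_on (\<lambda>e. c (g ` e)) ((\<lambda>u. {v, u}) ` N)"
    proof (rule inj_onI, clarify)
      fix a b assume ab: "a \<in> N" "b \<in> N" and "c (g ` {v, a}) = c (g ` {v, b})"
      then have "c {x, f a} = c {x, f b}" by (simp only: gN)
      then have "c {f a, x} = c {f b, x}" by (simp only: insert_commute)
      moreover have "f a \<in> W" "f b \<in> W" "f a \<noteq> x" "f b \<noteq> x"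
        using ab x f(2) \<open>N \<subseteq> S\<close> by auto
      ultimately have "f a = f b"
        using proper_edge_colouring_inj_at[OF proper] x(1) by blast
      then show "{v, a} = {v, b}" using ab f(1) \<open>N \<subseteq> S\<close> by (metis inj_onD subsetD)
    qed
    \<comment> \<open>Old and new colours differ by the choice of \<open>x\<close>.\<close>
    moreover have "c (g ` e) \<noteq> c (g ` {v, u})" if "e \<in> E" "u \<in> N" for e u
      using new[OF that(2,1)] gE[OF that(1)] gN[OF that(2)] by metis
    then have "(\<lambda>e. c (g ` e)) ` E \<inter> (\<lambda>e. c (g ` e)) ` (\<lambda>u. {v, u}) ` N = {}" by blast
    ultimately show ?thesis unfolding inj_on_Un by blast
  qed
  ultimately show ?thesis by blast
qed

text \<open>\<open>E \<inter> Pow S\<close> is the edge set of the subgraph induced by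
  \<open>S\<close>. An edge has exactly two ends, so one through \<open>v\<close> has its other end
  in \<open>S\<close>.\<close>

lemma nsets_2_Int_Pow_insert:
  assumes "E \<subseteq> nsets V 2" "v \<notin> S"
  shows "E \<inter> Pow (insert v S) = (E \<inter> Pow S) \<union> (\<lambda>u. {v, u}) ` {u \<in> S. {u, v} \<in> E}"
proof (intro equalityI subsetI)
  fix e assume e: "e \<in> E \<inter> Pow (insert v S)"
  then obtain a b where "e = {a, b}" "a \<noteq> b"
    using assms(1) by (auto simp: nsets_def card_2_iff)
  then show "e \<in> (E \<inter> Pow S) \<union> (\<lambda>u. {v, u}) ` {u \<in> S. {u, v} \<in> E}"
    using e by (cases "v \<in> e") (auto simp: insert_commute)
next
  fix e assume "e \<in> (E \<inter> Pow S) \<union> (\<lambda>u. {v, u}) ` {u \<in> S. {u, v} \<in> E}"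
  then consider "e \<in> E" "e \<subseteq> S" | u where "u \<in> S" "{u, v} \<in> E" "e = {u, v}"
    by (auto simp: insert_commute)
  then show "e \<in> E \<inter> Pow (insert v S)" by cases auto
qed

text \<open>Induction on the length \<open>m\<close> of the embedded prefix, with the subgraph that
  it induces; \<open>m = length vs\<close> gives all of the graph.\<close>

lemma rainbow_embedding_along_ordering:
  assumes "finite W" and proper: "proper_edge_colouring (nsets W 2) c"
    and E: "E \<subseteq> nsets (set vs) 2" and "distinct vs"
    and deg: "\<And>i. i < length vs \<Longrightarrow> card {j. j < i \<and> {vs ! j, vs ! i} \<in> E} \<le> k"
    and size: "k * card E - k + length vs \<le> card W"
    and "m \<le> length vs"
  shows "\<exists>f. inj_on f (set (take m vs)) \<and> f ` set (take m vs) \<subseteq> W \<and>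
    inj_on (\<lambda>e. c (f ` e)) (E \<inter> Pow (set (take m vs)))"
  using \<open>m \<le> length vs\<close>
proof (induction m)
  case 0
  have "E \<inter> Pow {} = {}" using E by (auto simp: nsets_def)
  then show ?case by simp
next
  case (Suc m)
  define S where "S = set (take m vs)"
  define v where "v = vs ! m"
  define N where "N = {u \<in> S. {u, v} \<in> E}"
  have m: "m < length vs" using Suc.prems by simp
  have S': "set (take (Suc m) vs) = insert v S"
    using m by (simp add: take_Suc_conv_app_nth S_def v_def)
  have nth_S: "S = (!) vs ` {..<m}"
    using m nth_image[of m vs] by (simp add: S_def atLeast0LessThan)
  have "v \<notin> S"
    using m \<open>distinct vs\<close> by (auto simp: nth_S v_def nth_eq_iff_index_eq)
  have cardS: "card S = m" using m \<open>distinct vs\<close> by (simp add: S_def distinct_card)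
  have finS: "finite S" by (simp add: S_def)
  have finE: "finite E"
    using E finite_imp_finite_nsets[of "set vs" 2] finite_subset by blast
  \<comment> \<open>The degeneracy bound counts positions in the ordering; this carries it over to
    vertices.\<close>
  have "N = (!) vs ` {j. j < m \<and> {vs ! j, vs ! m} \<in> E}"
    by (auto simp: N_def nth_S v_def)
  then have "card N \<le> k"
    using deg[OF m] card_image_le[of "{j. j < m \<and> {vs ! j, vs ! m} \<in> E}" "(!) vs"] by simp
  have split: "E \<inter> Pow (insert v S) = (E \<inter> Pow S) \<union> (\<lambda>u. {v, u}) ` N"
    unfolding N_def by (rule nsets_2_Int_Pow_insert[OF E \<open>v \<notin> S\<close>])
  \<comment> \<open>The saving of \<open>k\<close> arises here: if \<open>N\<close> is nonempty,
    some edge at \<open>v\<close> is not yet embedded, so at most \<open>card E - 1\<close> colours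
    are in use; if \<open>N\<close> is empty, the product is 0.\<close>
  have "card N * card (E \<inter> Pow S) \<le> k * card E - k"
  proof (cases "N = {}")
    case False
    then obtain u where "u \<in> N" by blast
    then have "{u, v} \<in> E" "{u, v} \<notin> E \<inter> Pow S" using \<open>v \<notin> S\<close> by (auto simp: N_def)
    then have "E \<inter> Pow S \<subset> E" by (metis Int_lower1 psubsetI)
    then have "card (E \<inter> Pow S) \<le> card E - 1"
      using psubset_card_mono[OF finE, of "E \<inter> Pow S"] by linarith
    with \<open>card N \<le> k\<close> have "card N * card (E \<inter> Pow S) \<le> k * (card E - 1)"
      by (rule mult_le_mono)
    then show ?thesis by (simp add: diff_mult_distrib2)
  qed simp
  \<comment> \<open>Strictness comes from \<open>card S = m < length vs\<close>.\<close>
  then have less: "card S + card N * card (E \<inter> Pow S) < card W"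
    using size m cardS by linarith
  obtain f where "inj_on f S" "f ` S \<subseteq> W" "inj_on (\<lambda>e. c (f ` e)) (E \<inter> Pow S)"
    using Suc by (auto simp: S_def)
  moreover have "E \<inter> Pow S \<subseteq> nsets S 2" using E by (auto simp: nsets_def)
  moreover have "N \<subseteq> S" by (auto simp: N_def)
  ultimately show ?case
    unfolding S' split
    using \<open>finite W\<close> proper finS finE \<open>v \<notin> S\<close> less by (intro extend_rainbow_embedding) simp_all
qed

lemma has_rainbow_copy_if_embedding:
  assumes "E \<subseteq> nsets V 2" and f: "inj_on f V" "f ` V \<subseteq> W" "inj_on (\<lambda>e. c (f ` e)) E"
  shows "has_rainbow_copy V E W (nsets W 2) c"
  unfolding has_rainbow_copy_def
proof (intro exI conjI)
  have "f ` e \<in> nsets (f ` V) 2" if "e \<in> E" for e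
  proof -
    have e: "e \<subseteq> V" "finite e" "card e = 2" using that assms(1) by (auto simp: nsets_def)
    then have "card (f ` e) = 2" using f(1) card_image inj_on_subset by metis
    then show ?thesis using e by (auto simp: nsets_def)
  qed
  then have "(`) f ` E \<subseteq> nsets (f ` V) 2" by blast
  then show "subgraph (f ` V) ((`) f ` E) W (nsets W 2)"
    using f(2) nsets_mono[OF f(2), of 2] unfolding subgraph_def simple_graph_def by blast
  \<comment> \<open>The backward direction uses that \<open>f\<close> is injective on subsets of
    \<open>V\<close>, which also covers \<open>u = v\<close>.\<close>
  have "{u, v} \<in> E \<longleftrightarrow> {f u, f v} \<in> (`) f ` E" if "u \<in> V" "v \<in> V" for u v
  proof
    assume "{f u, f v} \<in> (`) f ` E"
    then obtain e where e: "e \<in> E" "f ` {u, v} = f ` e" by auto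
    moreover have "e \<subseteq> V" using e assms(1) by (auto simp: nsets_def)
    ultimately have "{u, v} = e"
      using that inj_on_image_eq_iff[OF f(1), of "{u, v}" e] by auto
    then show "{u, v} \<in> E" using e by simp
  next
    assume "{u, v} \<in> E"
    then have "f ` {u, v} \<in> (`) f ` E" by (rule imageI)
    then show "{f u, f v} \<in> (`) f ` E" by simp
  qed
  then show "isomorphic V E (f ` V) ((`) f ` E)"
    unfolding isomorphic_def using inj_on_imp_bij_betw[OF f(1)] by blast
  show "inj_on c ((`) f ` E)"
    using f(3) by (intro inj_on_imageI) (simp add: comp_def)
qed

theorem theorem1p1:
  fixes V :: "'a set" and E :: "'a set set" and k :: nat
  assumes "finite_simple_graph V E"
    and "k = degeneracy V E"
  shows "AR V E \<le> enat (k * card E - k + card V)"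
proof -
  define n where "n = k * card E - k + card V"
  have V: "finite V" and E: "E \<subseteq> nsets V 2"
    using assms(1) by (auto simp: finite_simple_graph_def simple_graph_def)
  obtain vs where vs: "distinct vs" "set vs = V"
    and deg: "\<And>i. i < length vs \<Longrightarrow> card {j. j < i \<and> {vs ! j, vs ! i} \<in> E} \<le> k"
    using degeneracy_attained[OF V] assms(2) by blast
  have len: "length vs = card V" using vs distinct_card by fastforce
  have "has_rainbow_copy V E {..<n} (nsets {..<n} 2) c"
    if c: "proper_edge_colouring (nsets {..<n} 2) c" for c :: "nat set \<Rightarrow> nat"
  proof -
    have "E \<inter> Pow V = E" using E by (auto simp: nsets_def)
    then obtain f where "inj_on f V" "f ` V \<subseteq> {..<n}" "inj_on (\<lambda>e. c (f ` e)) E"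
      using rainbow_embedding_along_ordering[OF _ c, of E vs k "length vs"] E vs deg len
      by (auto simp: n_def)
    then show ?thesis using has_rainbow_copy_if_embedding[OF E] by blast
  qed
  \<comment> \<open>\<open>AR\<close> is an infimum, so it suffices that \<open>n\<close> lies in
    the set.\<close>
  then show ?thesis
    unfolding AR_def n_def[symmetric] by (intro Inf_lower) blast
qed

end
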